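(* Assume $F$ is known to the bidder and satisfies Assumptions 1 and 2 (with constants $\Delta,c_f,C_f,\lambda$), and $F(b^*_{v,F})>0$. Then for any $\gamma>1$ the regret of UCBid1 satisfies $$R_T^{v,F}\ \le\ \frac{2\gamma\lambda C_f^2}{F(b^*_{v,F})\,c_f}\log^2 T+O(\log T).$$
   Context: Model: at rounds $t=1,\dots,T$ a bidder submits $B_t\in[0,1]$. $(V_t)_{t\ge1}$ i.i.d. in $[0,1]$ with mean $v$; $(M_t)_{t\ge1}$ i.i.d. in $[0,1]$ with CDF $F$, independent of $(V_t)$. If $M_t\le B_t$ the bidder wins, pays $B_t$ and receives and observes $V_t$; otherwise she does not observe $V_t$. $U_{v,F}(b)=(v-b)F(b)$, $b^*_{v,F}=\max\{\operatorname{argmax}_{b\in[0,1]}U_{v,F}(b)\}$, regret $R_T^{v,F}=T\max_bU_{v,F}(b)-\sum_{t=1}^T\mathbb E[U_{v,F}(B_t)]$. Notation: $N_t=\sum_{s=1}^{t-1}\mathbf 1\{M_s\le B_s\}$, $\hat V_t=\frac1{N_t}\sum_{s=1}^{t-1}V_s\mathbf 1\{M_s\le B_s\}$, $\epsilon_t=\sqrt{\gamma\log(t-1)/(2N_t)}$. Algorithm UCBid1 (parameter $\gamma>0$): $B_1=1$, and for $t\ge2$, $B_t=\max\{\operatorname{argmax}_{b\in[0,1]}(\hat V_t+\epsilon_t-b)F(b)\}$. Assumption 1: $F$ is continuously differentiable with density $f$ and strictly log-concave ($f/F$ strictly decreasing on $(0,1)$). Assumption 2: $F$ has density $f$ with $c_f<f(b)<C_f$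 for $b\in[b^*_{v,F}-\Delta,b^*_{v,F}+\Delta]$, and $\phi_F:b\mapsto b+F(b)/f(b)$ has derivative at most $\lambda$ on $[b^*_{v,F},b^*_{v,F}+\Delta]$. *)

theory Defs
  imports "HOL-Probability.Probability"
begin

definition util :: "real \<Rightarrow> (real \<Rightarrow> real) \<Rightarrow> real \<Rightarrow> real" where
  "util v F b = (v - b) * F b"

definition max_argmax :: "(real \<Rightarrow> real) \<Rightarrow> real" where
  "max_argmax g = Sup {b \<in> {0..1}. \<forall>b'\<in>{0..1}. g b' \<le> g b}"

definition opt_bid :: "real \<Rightarrow> (real \<Rightarrow> real) \<Rightarrow> real" where
  "opt_bid v F = max_argmax (util v F)"

text \<open>An outcome omega assigns to every round t the pair (V_t, M_t) = omega t.
  Rounds are numbered 1,2,...; the entry omega 0 is unused.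
  Given the list bs = [B_1,...,B_n] of previous bids, the UCBid1 bid of
  round t = n+1 is computed as follows.\<close>
definition ucb_next :: "real \<Rightarrow> (real \<Rightarrow> real) \<Rightarrow> (nat \<Rightarrow> real \<times> real) \<Rightarrow> real list \<Rightarrow> real" where
  "ucb_next \<gamma> F \<omega> bs =
     (let n = length bs;
          won = {s \<in> {1..n}. snd (\<omega> s) \<le> bs ! (s - 1)};
          N = real (card won);
          Vhat = (\<Sum>s\<in>won. fst (\<omega> s)) / N;
          eps = sqrt (\<gamma> * ln (real n) / (2 * N))
      in if n = 0 then 1 else max_argmax (\<lambda>b. (Vhat + eps - b) * F b))"

primrec ucb_bids :: "real \<Rightarrow> (real \<Rightarrow> real) \<Rightarrow> (nat \<Rightarrow> real \<times> real) \<Rightarrow> nat \<Rightarrow> real list" where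
  "ucb_bids \<gamma> F \<omega> 0 = []"
| "ucb_bids \<gamma> F \<omega> (Suc n) = ucb_bids \<gamma> F \<omega> n @ [ucb_next \<gamma> F \<omega> (ucb_bids \<gamma> F \<omega> n)]"

definition ucb_bid :: "real \<Rightarrow> (real \<Rightarrow> real) \<Rightarrow> (nat \<Rightarrow> real \<times> real) \<Rightarrow> nat \<Rightarrow> real" where
  "ucb_bid \<gamma> F \<omega> t = ucb_next \<gamma> F \<omega> (ucb_bids \<gamma> F \<omega> (t - 1))"

definition outcome_space :: "real measure \<Rightarrow> real measure \<Rightarrow> (nat \<Rightarrow> real \<times> real) measure" where
  "outcome_space DV DM = PiM UNIV (\<lambda>_. DV \<Otimes>\<^sub>M DM)"

definition ucb_regret :: "real \<Rightarrow> real measure \<Rightarrow> real measure \<Rightarrow> real \<Rightarrow> (real \<Rightarrow> real) \<Rightarrow> nat \<Rightarrow> real" where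
  "ucb_regret \<gamma> DV DM v F T =
     real T * Sup (util v F ` {0..1})
     - (\<Sum>t=1..T. integral\<^sup>L (outcome_space DV DM) (\<lambda>\<omega>. util v F (ucb_bid \<gamma> F \<omega> t)))"

end

theory Submission
  imports Defs "HOL-Probability.Hoeffding"
begin

text \<open>
  Let \<open>b(w)\<close> be the largest maximizer of \<open>(w - b) F(b)\<close>, so that \<open>b\<^sup>* = b(v)\<close>. Comparing the two
  optimality conditions bounds the loss of bidding \<open>b(w)\<close>, \<open>w \<ge> v\<close>, by
  \<open>(w - v) (F(b(w)) - F(b\<^sup>*))\<close>, and log-concavity of \<open>F\<close> makes \<open>b\<close> 1-Lipschitz, so the loss is at
  most \<open>C\<^sub>f (w - v)\<^sup>2\<close>. As long as the empirical mean lies within \<open>\<epsilon>\<^sub>t\<close> of \<open>v\<close>, this is at most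
  \<open>4 C\<^sub>f \<epsilon>\<^sub>t\<^sup>2 = 2 \<gamma> C\<^sub>f log (t - 1) / N\<^sub>t\<close>.

  The number of wins is random, so the deviation of the empirical mean is controlled by
  the exponential supermartingale \<open>exp (\<theta> (S\<^sub>t - v N\<^sub>t) - \<theta>\<^sup>2 N\<^sub>t / 8)\<close>, with \<open>S\<^sub>t\<close> the sum of the
  observed values, and peeling over geometric slices of \<open>N\<^sub>t\<close>; for every \<open>\<gamma> > 1\<close> the failure
  probabilities are summable. Bids below \<open>b\<^sup>*\<close> occur only after such failures, hence a bounded
  expected number of times, and \<open>N\<^sub>t \<ge> c t\<close> holds outside an event of probability \<open>O(1/t)\<close> for each
  \<open>c < F(b\<^sup>*)\<close>. Choosing \<open>c = F(b\<^sup>*) c\<^sub>f / C\<^sub>f\<close> and summing \<open>log t / t\<close> gives the claim, since the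
  slope bound \<open>\<lambda>\<close> of \<open>\<phi>\<^sub>F\<close> is at least 1.
\<close>

section \<open>Optimal bids\<close>

text \<open>The maximizers form a nonempty closed superlevel set of a continuous function on a
  compact interval, so \<open>Sup\<close> is itself a maximizer. The third claim makes every bid to
  the right of it strictly worse.\<close>

lemma opt_bid_maximizes:
  fixes F :: "real \<Rightarrow> real"
  assumes F: "continuous_on {0..1} F"
  shows opt_bid_mem: "opt_bid w F \<in> {0..1}"
    and util_le_opt_bid: "\<And>b. b \<in> {0..1} \<Longrightarrow> util w F b \<le> util w F (opt_bid w F)"
    and le_opt_bid: "\<And>b. b \<in> {0..1} \<Longrightarrow> util w F (opt_bid w F) \<le> util w F b \<Longrightarrow> b \<le> opt_bid w F"
proof -
  let ?A = "{b \<in> {0..1}. \<forall>b'\<in>{0..1}. util w F b' \<le> util w F b}"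
  have cont: "continuous_on {0..1} (util w F)"
    unfolding util_def by (intro continuous_intros F)
  obtain x where x: "x \<in> {0..1}" "\<forall>y\<in>{0..1}. util w F y \<le> util w F x"
    using continuous_attains_sup[OF compact_Icc _ cont] by auto
  have A: "?A = {b \<in> {0..1}. util w F x \<le> util w F b}"
    using x by force
  have "closed ?A"
    unfolding A by (intro continuous_on_closed_Collect_le continuous_on_const cont closed_atLeastAtMost)
  moreover have "?A \<noteq> {}" "bdd_above ?A"
    using x by (auto intro!: bdd_aboveI[of _ 1])
  ultimately have *: "Sup ?A \<in> ?A"
    by (intro closed_contains_Sup)
  then show "opt_bid w F \<in> {0..1}"
    and 1: "\<And>b. b \<in> {0..1} \<Longrightarrow> util w F b \<le> util w F (opt_bid w F)"
    unfolding opt_bid_def max_argmax_def by auto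
  fix b :: real assume b: "b \<in> {0..1}" "util w F (opt_bid w F) \<le> util w F b"
  then have "b \<in> ?A"
    using 1 by force
  then show "b \<le> opt_bid w F"
    unfolding opt_bid_def max_argmax_def
    using \<open>bdd_above ?A\<close> by (rule cSup_upper)
qed

text \<open>Revealed preference: adding the two optimality conditions gives
  \<open>(w' - w) * (F b' - F b) \<ge> 0\<close>, which rules out a reversed order of the bids
  \<open>b\<close> and \<open>b'\<close> when \<open>F\<close> is strictly increasing.\<close>

lemma opt_bid_mono:
  fixes F :: "real \<Rightarrow> real"
  assumes F: "continuous_on {0..1} F" "strict_mono_on {0..1} F" and "w \<le> w'"
  shows "opt_bid w F \<le> opt_bid w' F"
proof (rule ccontr)
  assume "\<not> ?thesis"
  then have less: "opt_bid w' F < opt_bid w F" by simp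
  then have "w < w'" using \<open>w \<le> w'\<close> by (cases "w = w'") auto
  have "F (opt_bid w' F) < F (opt_bid w F)"
    using strict_mono_onD[OF F(2) opt_bid_mem[OF F(1)] opt_bid_mem[OF F(1)] less] .
  then have "(w' - w) * (F (opt_bid w F) - F (opt_bid w' F)) > 0"
    using \<open>w < w'\<close> by simp
  moreover have "util w F (opt_bid w' F) \<le> util w F (opt_bid w F)"
    "util w' F (opt_bid w F) \<le> util w' F (opt_bid w' F)"
    using util_le_opt_bid[OF F(1)] opt_bid_mem[OF F(1)] by blast+
  ultimately show False
    unfolding util_def by (simp add: algebra_simps)
qed

text \<open>Optimality of \<open>opt_bid w F\<close> at value \<open>w\<close>, rewritten with
  \<open>util w F b = util v F b + (w - v) * F b\<close>.\<close>

lemma util_opt_bid_diff_le: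
  fixes F :: "real \<Rightarrow> real"
  assumes F: "continuous_on {0..1} F"
  shows "util v F (opt_bid v F) - util v F (opt_bid w F)
    \<le> (w - v) * (F (opt_bid w F) - F (opt_bid v F))"
  using util_le_opt_bid[OF F opt_bid_mem[OF F], of w v]
  unfolding util_def by (simp add: algebra_simps)

text \<open>The inequality \<open>F y * F x \<le> F (x + d) * F (y - d)\<close> for \<open>x \<le> y - d\<close> is the
  derivative-free form of log-concavity; it prevents the two optimality conditions below from
  holding simultaneously.\<close>

lemma opt_bid_Lipschitz:
  fixes F :: "real \<Rightarrow> real"
  assumes F: "continuous_on {0..1} F" "strict_mono_on {0..1} F" "0 \<le> F 0"
    and logconc: "\<And>x y d. 0 \<le> x \<Longrightarrow> 0 < F x \<Longrightarrow> 0 \<le> d \<Longrightarrow> x \<le> y - d \<Longrightarrow> y \<le> 1 \<Longrightarrow>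
      F y * F x \<le> F (x + d) * F (y - d)"
    and v: "0 \<le> v" "v \<le> w" and pos: "0 < F (opt_bid v F)"
  shows "opt_bid w F - opt_bid v F \<le> w - v"
proof (rule ccontr)
  define b b' d where "b = opt_bid v F" and "b' = opt_bid w F" and "d = w - v"
  note b = opt_bid_mem[OF F(1), of v, folded b_def] and b' = opt_bid_mem[OF F(1), of w, folded b'_def]
  assume "\<not> ?thesis"
  then have less: "b < b' - d" and d: "0 \<le> d"
    using v by (auto simp: b_def b'_def d_def)
  then have b'd: "b' - d \<in> {0..1}" "b + d \<in> {0..1}" using b b' by auto
  \<comment> \<open>Bidding 0 earns at least 0, so an optimal bid that can win does not exceed the
    value.\<close>
  have "util v F 0 \<le> util v F b"
    using util_le_opt_bid[OF F(1)] unfolding b_def by simp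
  moreover have "0 \<le> util v F 0"
    using v F(3) by (simp add: util_def)
  ultimately have vb: "0 \<le> v - b"
    using pos unfolding util_def b_def[symmetric] by (metis mult_neg_pos not_le order_trans)
  \<comment> \<open>At value \<open>v\<close> the shifted bid \<open>b' - d\<close> keeps the margin
    \<open>w - b'\<close>; it lies beyond the largest maximizer, hence the strict inequality. In the
    next step \<open>b + d\<close> at value \<open>w\<close> keeps the margin
    \<open>v - b\<close>.\<close>
  have 1: "(w - b') * F (b' - d) < (v - b) * F b"
    using le_opt_bid[OF F(1) b'd(1), of v] less
    unfolding b_def[symmetric] by (force simp: util_def d_def)
  have 2: "(v - b) * F (b + d) \<le> (w - b') * F b'"
    using util_le_opt_bid[OF F(1) b'd(2), of w]
    unfolding b'_def[symmetric] by (simp add: util_def d_def)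
  have Fb: "0 < F b" using pos by (simp add: b_def)
  have less_F: "F b < F b'" "F b < F (b' - d)" "F b \<le> F (b + d)"
    using strict_mono_onD[OF F(2) b b'] strict_mono_onD[OF F(2) b b'd(1)]
      strict_mono_on_leD[OF F(2) b b'd(2)] less d by auto
  have "0 \<le> (w - b') * F b'"
    using 2 vb less_F(3) Fb by (intro order_trans[OF _ 2] mult_nonneg_nonneg) auto
  then have p: "0 \<le> w - b'"
    using less_F Fb by (simp add: zero_le_mult_iff)
  \<comment> \<open>Log-concavity followed by the two optimality conditions leads back to the
    starting quantity, with one strict step.\<close>
  have "(w - b') * (F b' * F b) \<le> (w - b') * (F (b + d) * F (b' - d))"
    using b b' less d Fb by (intro mult_left_mono p logconc) auto
  also have "\<dots> < (v - b) * F b * F (b + d)"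
    using mult_strict_right_mono[OF 1, of "F (b + d)"] less_F Fb by (simp add: mult_ac)
  also have "\<dots> \<le> (w - b') * F b' * F b"
    using mult_right_mono[OF 2, of "F b"] Fb by (simp add: mult_ac)
  finally show False by (simp add: mult_ac)
qed

section \<open>Log-concave price distributions\<close>

locale log_concave_cdf =
  fixes DM :: "real measure" and F f :: "real \<Rightarrow> real"
  assumes DM: "prob_space DM" "sets DM = sets borel" "AE x in DM. x \<in> {0..1}"
    and cdf: "\<And>b. measure DM {..b} = F b"
    and deriv: "\<And>b. b \<in> {0..1} \<Longrightarrow> (F has_real_derivative f b) (at b within {0..1})"
    and logconc: "\<And>x y. 0 < x \<Longrightarrow> x < y \<Longrightarrow> y < 1 \<Longrightarrow> f y / F y < f x / F x"
begin

sublocale M: prob_space DM by (fact DM)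

lemma sets_DM [measurable_cong]: "sets DM = sets borel" by (fact DM)

lemma cdf_nonneg: "0 \<le> F b"
  unfolding cdf[symmetric] by simp

lemma cdf_le_1: "F b \<le> 1"
  unfolding cdf[symmetric] by simp

lemma cdf_mono: "mono F"
  unfolding cdf[symmetric] by (intro monoI M.finite_measure_mono) auto

lemma cdf_1: "F 1 = 1"
proof -
  have "AE x in DM. x \<in> {..1}" using DM(3) by eventually_elim auto
  then show ?thesis
    unfolding cdf[symmetric] by (subst M.prob_eq_1) auto
qed

lemma cdf_continuous: "continuous_on {0..1} F"
  using deriv by (intro DERIV_continuous_on) auto

lemma cdf_deriv: "0 < b \<Longrightarrow> b < 1 \<Longrightarrow> (F has_real_derivative f b) (at b)"
  using deriv[of b] at_within_interior[of b "{0..1}"] by simp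

lemma density_nonneg: "0 < b \<Longrightarrow> b < 1 \<Longrightarrow> 0 \<le> f b"
  by (rule mono_on_imp_deriv_nonneg[of UNIV F "f b" b])
    (auto intro: cdf_deriv mono_on_subset[OF cdf_mono])

text \<open>The strictly decreasing ratio exceeds its nonnegative value at the midpoint of
  \<open>b\<close> and 1, so it is positive. As division by 0 yields 0, neither numerator nor
  denominator can vanish.\<close>

lemma density_cdf_pos:
  assumes "0 < b" "b < 1"
  shows "0 < f b" "0 < F b"
proof -
  have "0 \<le> f ((b + 1) / 2) / F ((b + 1) / 2)"
    using assms by (intro divide_nonneg_nonneg density_nonneg cdf_nonneg) auto
  also have "\<dots> < f b / F b"
    using assms by (intro logconc) auto
  finally show "0 < f b" "0 < F b"
    using density_nonneg[OF assms] cdf_nonneg[of b] by (auto simp: zero_less_divide_iff)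
qed

lemma cdf_strict_mono: "strict_mono_on {0..1} F"
proof (rule strict_mono_onI)
  fix x y :: real assume "x \<in> {0..1}" "y \<in> {0..1}" "x < y"
  then show "F x < F y"
    by (intro DERIV_pos_imp_increasing_open[of x y F] exI[of _ "f _"])
      (auto intro: continuous_on_subset[OF cdf_continuous] cdf_deriv density_cdf_pos)
qed

text \<open>The map \<open>z \<mapsto> ln (F (z + d)) - ln (F z)\<close> has derivative at most 0
  because \<open>f / F\<close> decreases; compare its values at \<open>x\<close> and
  \<open>y - d\<close>. Both degenerate cases are equalities.\<close>

lemma cdf_log_concave:
  assumes x: "0 \<le> x" "0 < F x" and d: "0 \<le> d" and y: "x \<le> y - d" "y \<le> 1"
  shows "F y * F x \<le> F (x + d) * F (y - d)"
proof (cases "x = y - d \<or> d = 0")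
  case False
  with assms have less: "x < y - d" "0 < d" by auto
  have pos: "0 < F z" if "x \<le> z" for z
    using x that monoD[OF cdf_mono, of x z] by simp
  have "\<exists>l. ((\<lambda>z. ln (F (z + d)) - ln (F z)) has_real_derivative l) (at z) \<and> l \<le> 0"
    if z: "x < z" "z < y - d" for z
  proof (intro exI conjI)
    have z': "0 < z" "z < z + d" "z + d < 1" using z less assms by auto
    show "((\<lambda>z. ln (F (z + d)) - ln (F z)) has_real_derivative f (z + d) / F (z + d) - f z / F z) (at z)"
    proof (rule DERIV_diff)
      have "((\<lambda>z. F (z + d)) has_real_derivative f (z + d)) (at z)"
        unfolding DERIV_shift[symmetric] using z' by (intro cdf_deriv) auto
      from DERIV_chain2[OF DERIV_ln_divide this]
      show "((\<lambda>z. ln (F (z + d))) has_real_derivative f (z + d) / F (z + d)) (at z)"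
        using pos[of "z + d"] z d by simp
      from DERIV_chain2[OF DERIV_ln_divide cdf_deriv]
      show "((\<lambda>z. ln (F z)) has_real_derivative f z / F z) (at z)"
        using pos[of z] z z' by simp
    qed
    show "f (z + d) / F (z + d) - f z / F z \<le> 0"
      using logconc[OF z'] by simp
  qed
  moreover have "continuous_on {x..y - d} (\<lambda>z. ln (F (z + d)) - ln (F z))"
  proof (intro continuous_intros)
    show "continuous_on {x..y - d} F"
      using assms by (intro continuous_on_subset[OF cdf_continuous]) auto
    show "continuous_on {x..y - d} (\<lambda>z. F (z + d))"
      using assms by (intro continuous_on_compose2[OF cdf_continuous] continuous_intros) auto
    show "\<forall>z\<in>{x..y - d}. F (z + d) \<noteq> 0" "\<forall>z\<in>{x..y - d}. F z \<noteq> 0"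
      using pos d by (metis add_increasing2 atLeastAtMost_iff less_irrefl)+
  qed
  ultimately have "ln (F (y - d + d)) - ln (F (y - d)) \<le> ln (F (x + d)) - ln (F x)"
    using less by (intro DERIV_nonpos_imp_decreasing_open[of x "y - d"]) auto
  moreover have "0 < F y" "0 < F (y - d)" "0 < F (x + d)"
    using pos less by auto
  ultimately have "ln (F y * F x) \<le> ln (F (x + d) * F (y - d))"
    using x by (simp add: ln_mult)
  then show ?thesis
    using x pos[of y] pos[of "x + d"] pos[of "y - d"] less by simp
next
  case True
  then show ?thesis
    by (elim disjE) (simp_all add: mult.commute)
qed

text \<open>\<open>F / f\<close> is the reciprocal of a decreasing positive function, so its
  derivative is nonnegative, and the identity contributes 1. This gives \<open>1 \<le> lam\<close>
  in the final bound.\<close>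

lemma one_le_reserve_slope:
  assumes b: "0 < b" "b < 1"
    and d: "((\<lambda>x. x + F x / f x) has_real_derivative d) (at b within {0..1})"
  shows "1 \<le> d"
proof -
  have "((\<lambda>x. x + F x / f x) has_real_derivative d) (at b)"
    using d b at_within_interior[of b "{0..1}"] by simp
  from DERIV_diff[OF this DERIV_ident]
  have der: "((\<lambda>x. F x / f x) has_real_derivative d - 1) (at b)" by simp
  have "mono_on {0<..<1} (\<lambda>x. F x / f x)"
  proof (rule mono_onI)
    fix x y :: real assume xy: "x \<in> {0<..<1}" "y \<in> {0<..<1}" "x \<le> y"
    then have pos: "0 < f x" "0 < F x" "0 < f y" "0 < F y"
      using density_cdf_pos by auto
    have "f y / F y \<le> f x / F x"
      using logconc[of x y] xy by (cases "x = y") auto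
    then show "F x / f x \<le> F y / f y"
      using pos by (simp add: divide_le_eq pos_le_divide_eq mult.commute)
  qed
  from mono_on_imp_deriv_nonneg[OF this der] have "0 \<le> d - 1"
    using b by (simp add: interior_open)
  then show ?thesis by simp
qed

end

section \<open>Exponential moments on product spaces\<close>

text \<open>Replacing one coordinate by an independent fresh copy preserves the product law. This
  stands in for conditioning on all other rounds.\<close>

lemma nn_integral_PiM_resample:
  fixes M :: "'a measure" and G :: "('i \<Rightarrow> 'a) \<Rightarrow> ennreal"
  assumes M: "prob_space M" and G: "G \<in> borel_measurable (PiM UNIV (\<lambda>_. M))"
  shows "(\<integral>\<^sup>+\<omega>. G \<omega> \<partial>PiM UNIV (\<lambda>_. M)) = (\<integral>\<^sup>+\<omega>. \<integral>\<^sup>+x. G (fun_upd \<omega> i x) \<partial>M \<partial>PiM UNIV (\<lambda>_. M))"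
proof -
  let ?P = "PiM UNIV (\<lambda>_::'i. M)"
  interpret M: prob_space M by fact
  interpret P: prob_space ?P by (intro prob_space_PiM M)
  interpret pair_sigma_finite M ?P ..
  have up [measurable]: "(\<lambda>(x, X). X(i := x)) \<in> measurable (M \<Otimes>\<^sub>M ?P) ?P"
    unfolding case_prod_beta
    by (intro measurable_fun_upd[where J = UNIV] measurable_fst measurable_snd) auto
  have "(\<integral>\<^sup>+\<omega>. G \<omega> \<partial>?P) = (\<integral>\<^sup>+\<omega>. G \<omega> \<partial>distr (M \<Otimes>\<^sub>M ?P) ?P (\<lambda>(x, X). X(i := x)))"
    using distr_pair_PiM_eq_PiM[of UNIV "\<lambda>_. M" i] M by simp
  also have "\<dots> = (\<integral>\<^sup>+z. G ((\<lambda>(x, X). X(i := x)) z) \<partial>(M \<Otimes>\<^sub>M ?P))"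
    using G by (intro nn_integral_distr) auto
  also have "\<dots> = (\<integral>\<^sup>+\<omega>. \<integral>\<^sup>+x. G (fun_upd \<omega> i x) \<partial>M \<partial>?P)"
    using measurable_compose[OF up G] by (subst nn_integral_snd[symmetric]) auto
  finally show ?thesis .
qed

text \<open>A product of nonnegative factors, each of conditional mean at most 1 given the past, has
  mean at most 1: integrate out the last round, which the earlier factors do not see.\<close>

lemma nn_integral_PiM_prod_le_1:
  fixes M :: "'a measure" and h :: "nat \<Rightarrow> (nat \<Rightarrow> 'a) \<Rightarrow> 'a \<Rightarrow> ennreal"
  assumes M: "prob_space M"
    and meas: "\<And>n. (\<lambda>\<omega>. h n \<omega> (\<omega> n)) \<in> borel_measurable (PiM UNIV (\<lambda>_. M))"
      "\<And>n \<omega>. h n \<omega> \<in> borel_measurable M"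
    and nonanticipating: "\<And>n i \<omega> x. n \<le> i \<Longrightarrow> h n (fun_upd \<omega> i x) = h n \<omega>"
    and le_1: "\<And>n \<omega>. (\<integral>\<^sup>+x. h n \<omega> x \<partial>M) \<le> 1"
  shows "(\<integral>\<^sup>+\<omega>. (\<Prod>s=1..n. h s \<omega> (\<omega> s)) \<partial>PiM UNIV (\<lambda>_. M)) \<le> 1"
proof (induction n)
  case 0
  interpret P: prob_space "PiM UNIV (\<lambda>_::nat. M)" by (intro prob_space_PiM M)
  show ?case by (simp add: P.emeasure_space_1)
next
  case (Suc n)
  let ?P = "PiM UNIV (\<lambda>_::nat. M)" and ?G = "\<lambda>\<omega>. \<Prod>s=1..n. h s \<omega> (\<omega> s)"
  have "(\<integral>\<^sup>+\<omega>. (\<Prod>s=1..Suc n. h s \<omega> (\<omega> s)) \<partial>?P)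
      = (\<integral>\<^sup>+\<omega>. \<integral>\<^sup>+x. (\<Prod>s=1..Suc n. h s (fun_upd \<omega> (Suc n) x) (fun_upd \<omega> (Suc n) x s)) \<partial>M \<partial>?P)"
    by (rule nn_integral_PiM_resample[OF M]) (intro borel_measurable_prod_ennreal meas)
  also have "\<dots> = (\<integral>\<^sup>+\<omega>. \<integral>\<^sup>+x. ?G \<omega> * h (Suc n) \<omega> x \<partial>M \<partial>?P)"
  proof (intro nn_integral_cong)
    fix \<omega> x
    have "(\<Prod>s=1..n. h s (fun_upd \<omega> (Suc n) x) (fun_upd \<omega> (Suc n) x s)) = ?G \<omega>"
      by (intro prod.cong) (auto simp: nonanticipating)
    then show "(\<Prod>s=1..Suc n. h s (fun_upd \<omega> (Suc n) x) (fun_upd \<omega> (Suc n) x s)) = ?G \<omega> * h (Suc n) \<omega> x"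
      by (simp add: nonanticipating mult.commute)
  qed
  also have "\<dots> = (\<integral>\<^sup>+\<omega>. ?G \<omega> * (\<integral>\<^sup>+x. h (Suc n) \<omega> x \<partial>M) \<partial>?P)"
    by (intro nn_integral_cong nn_integral_cmult meas)
  also have "\<dots> \<le> (\<integral>\<^sup>+\<omega>. ?G \<omega> * 1 \<partial>?P)"
    by (intro nn_integral_mono mult_left_mono le_1) auto
  also have "\<dots> \<le> 1" using Suc by simp
  finally show ?case .
qed

text \<open>Hoeffding's lemma for parameters of either sign; a negative one is handled by passing to
  \<open>- f\<close>, whose range also has length 1.\<close>

lemma (in prob_space) Hoeffding_mgf_unit_interval:
  fixes f :: "'a \<Rightarrow> real"
  assumes f [measurable]: "f \<in> borel_measurable M" and bnd: "AE x in M. f x \<in> {0..1}"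
  shows "(\<integral>\<^sup>+x. ennreal (exp (\<theta> * (f x - expectation f))) \<partial>M) \<le> ennreal (exp (\<theta>\<^sup>2 / 8))"
proof -
  consider "\<theta> = 0" | "\<theta> > 0" | "\<theta> < 0" by linarith
  then show ?thesis
  proof cases
    case 1
    then show ?thesis by (simp add: emeasure_space_1)
  next
    case 2
    interpret interval_bounded_random_variable M f 0 1
      by unfold_locales (use bnd in auto)
    show ?thesis
      using Hoeffdings_lemma_nn_integral[OF 2] by simp
  next
    case 3
    interpret interval_bounded_random_variable M "\<lambda>x. - f x" "-1" 0
      by unfold_locales (use bnd in auto)
    show ?thesis
      using Hoeffdings_lemma_nn_integral[of "- \<theta>"] 3 by (simp add: algebra_simps)
  qed
qed

section \<open>The UCBid1 bids\<close>

text \<open>After \<open>n\<close> completed rounds, \<open>ucb_wins\<close> is the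
  \<open>N_t\<close> of the algorithm for \<open>t = n + 1\<close>, and \<open>ucb_gain\<close> is
  \<open>N_t\<close> times the empirical mean. Sums of indicators fit the product form of the
  exponential moments.\<close>

definition ucb_wins :: "real \<Rightarrow> (real \<Rightarrow> real) \<Rightarrow> (nat \<Rightarrow> real \<times> real) \<Rightarrow> nat \<Rightarrow> real" where
  "ucb_wins \<gamma> F \<omega> n = (\<Sum>s=1..n. of_bool (snd (\<omega> s) \<le> ucb_bid \<gamma> F \<omega> s))"

definition ucb_gain :: "real \<Rightarrow> (real \<Rightarrow> real) \<Rightarrow> (nat \<Rightarrow> real \<times> real) \<Rightarrow> nat \<Rightarrow> real" where
  "ucb_gain \<gamma> F \<omega> n = (\<Sum>s=1..n. of_bool (snd (\<omega> s) \<le> ucb_bid \<gamma> F \<omega> s) * fst (\<omega> s))"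

lemma length_ucb_bids [simp]: "length (ucb_bids \<gamma> F \<omega> n) = n"
  by (induction n) auto

lemma ucb_bids_nth: "s \<in> {1..n} \<Longrightarrow> ucb_bids \<gamma> F \<omega> n ! (s - 1) = ucb_bid \<gamma> F \<omega> s"
proof (induction n)
  case (Suc n)
  then show ?case
    by (cases "s = Suc n") (auto simp: nth_append ucb_bid_def)
qed simp

text \<open>The unplayed round 0 also gets bid 1, since \<open>0 - 1 = 0\<close> on
  naturals.\<close>

lemma ucb_bid_1 [simp]: "ucb_bid \<gamma> F \<omega> (Suc 0) = 1" "ucb_bid \<gamma> F \<omega> 0 = 1"
  by (simp_all add: ucb_bid_def ucb_next_def)

text \<open>UCBid1 bids optimally for an optimistic value, so properties of \<open>opt_bid\<close>
  in its value argument transfer to the algorithm.\<close>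

lemma ucb_bid_Suc:
  assumes "n > 0"
  shows "ucb_bid \<gamma> F \<omega> (Suc n) = opt_bid (ucb_gain \<gamma> F \<omega> n / ucb_wins \<gamma> F \<omega> n
    + sqrt (\<gamma> * ln (real n) / (2 * ucb_wins \<gamma> F \<omega> n))) F"
proof -
  have won: "{s \<in> {1..n}. snd (\<omega> s) \<le> ucb_bids \<gamma> F \<omega> n ! (s - 1)}
      = {s \<in> {1..n}. snd (\<omega> s) \<le> ucb_bid \<gamma> F \<omega> s}" (is "_ = ?W")
    by (intro Collect_cong conj_cong refl) (simp add: ucb_bids_nth del: One_nat_def)
  have "ucb_wins \<gamma> F \<omega> n = real (card ?W)"
    unfolding ucb_wins_def of_bool_def
    by (simp add: sum.inter_filter[symmetric])
  moreover have "ucb_gain \<gamma> F \<omega> n = (\<Sum>s\<in>?W. fst (\<omega> s))"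
    unfolding ucb_gain_def of_bool_def
    by (subst sum.inter_filter) (auto intro!: sum.cong)
  ultimately have "ucb_next \<gamma> F \<omega> (ucb_bids \<gamma> F \<omega> n) = opt_bid (ucb_gain \<gamma> F \<omega> n / ucb_wins \<gamma> F \<omega> n
    + sqrt (\<gamma> * ln (real n) / (2 * ucb_wins \<gamma> F \<omega> n))) F"
    using assms unfolding ucb_next_def Let_def length_ucb_bids won opt_bid_def util_def[abs_def]
    by (simp del: One_nat_def)
  moreover have "ucb_bid \<gamma> F \<omega> (Suc n) = ucb_next \<gamma> F \<omega> (ucb_bids \<gamma> F \<omega> n)"
    unfolding ucb_bid_def by simp
  ultimately show ?thesis by simp
qed

lemma ucb_next_fun_upd:
  assumes "length bs < i"
  shows "ucb_next \<gamma> F (fun_upd \<omega> i x) bs = ucb_next \<gamma> F \<omega> bs"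
proof -
  have "{s \<in> {1..length bs}. snd (fun_upd \<omega> i x s) \<le> bs ! (s - 1)}
     = {s \<in> {1..length bs}. snd (\<omega> s) \<le> bs ! (s - 1)}" (is "_ = ?W")
    using assms by auto
  moreover have "(\<Sum>s\<in>?W. fst (fun_upd \<omega> i x s)) = (\<Sum>s\<in>?W. fst (\<omega> s))"
    using assms by (intro sum.cong) auto
  ultimately show ?thesis
    by (simp add: ucb_next_def Let_def del: One_nat_def fun_upd_apply)
qed

lemma ucb_bids_fun_upd: "n \<le> i \<Longrightarrow> ucb_bids \<gamma> F (fun_upd \<omega> i x) n = ucb_bids \<gamma> F \<omega> n"
  by (induction n) (simp_all add: ucb_next_fun_upd)

text \<open>Bids are predictable: the bid of round \<open>t\<close> ignores the outcome of round
  \<open>t\<close> and all later ones.\<close>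

lemma ucb_bid_fun_upd: "t \<le> i \<Longrightarrow> ucb_bid \<gamma> F (fun_upd \<omega> i x) t = ucb_bid \<gamma> F \<omega> t"
  by (cases t) (simp_all add: ucb_bid_def[of _ _ _ "Suc _"] ucb_bids_fun_upd ucb_next_fun_upd)

lemma ucb_wins_le: "ucb_wins \<gamma> F \<omega> n \<le> real n"
proof -
  have "ucb_wins \<gamma> F \<omega> n \<le> (\<Sum>s=1..n. 1)"
    unfolding ucb_wins_def by (intro sum_mono) simp
  then show ?thesis by simp
qed

section \<open>Deviation of the empirical mean\<close>

text \<open>With \<open>u = sqrt N / (1 + \<kappa>) ^ k\<close> the right-hand side below is at least \<open>2 * x * (2 * u - u\<^sup>2)\<close>,
  which is at least \<open>2 * x * (1 - \<kappa>\<^sup>2)\<close> for \<open>1 \<le> u \<le> 1 + \<kappa>\<close>: on one slice of the peeling a single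
  exponent costs only the factor \<open>1 - \<kappa>\<^sup>2\<close> compared to the optimal one.\<close>

lemma peeling_exponent_ge:
  fixes x \<kappa> N D :: real
  assumes x: "0 \<le> x" and \<kappa>: "0 < \<kappa>" and N: "0 \<le> N"
    and k: "(1 + \<kappa>) ^ k \<le> sqrt N" "sqrt N \<le> (1 + \<kappa>) ^ Suc k"
    and D: "sqrt (x * N) \<le> D" and \<theta>: "\<theta> = 4 * sqrt x / (1 + \<kappa>) ^ k"
  shows "2 * x * (1 - \<kappa>\<^sup>2) \<le> \<theta> * D - \<theta>\<^sup>2 / 8 * N"
proof -
  define r u where "r = (1 + \<kappa>) ^ k" and "u = sqrt N / r"
  have r: "0 < r" using \<kappa> by (simp add: r_def)
  have u: "1 \<le> u" "u \<le> 1 + \<kappa>"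
    using k r by (simp_all add: u_def r_def[symmetric] divide_simps mult.commute)
  have N_eq: "N = (u * r)\<^sup>2" and sqrtN: "sqrt N = u * r"
    using r N by (simp_all add: u_def)
  have "(u - 1)\<^sup>2 \<le> \<kappa>\<^sup>2" using u by (intro power_mono) auto
  then have "2 * x * (1 - \<kappa>\<^sup>2) \<le> 2 * x * (1 - (u - 1)\<^sup>2)"
    using x by (intro mult_left_mono) auto
  also have "\<dots> = 4 * x * u - 2 * x * u\<^sup>2"
    by (simp add: power2_eq_square algebra_simps)
  also have "4 * x * u = \<theta> * sqrt (x * N)"
    using r x by (simp add: \<theta> r_def[symmetric] real_sqrt_mult sqrtN)
  also have "2 * x * u\<^sup>2 = \<theta>\<^sup>2 / 8 * N"
    using r x by (simp add: \<theta> r_def[symmetric] N_eq power_mult_distrib power_divide)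
  also have "\<theta> * sqrt (x * N) - \<theta>\<^sup>2 / 8 * N \<le> \<theta> * D - \<theta>\<^sup>2 / 8 * N"
    using D x r by (intro diff_right_mono mult_left_mono) (auto simp: \<theta> r_def)
  finally show ?thesis by simp
qed

lemma power_bracket:
  fixes q y :: real
  assumes "1 < q" "1 \<le> y"
  obtains k :: nat where "q ^ k \<le> y" "y \<le> q ^ Suc k"
proof -
  obtain n where n: "y < q ^ n" using real_arch_pow[OF assms(1)] by blast
  define m where "m = (LEAST n. y < q ^ n)"
  have m: "y < q ^ m" unfolding m_def by (rule LeastI, rule n)
  with assms(2) obtain k where k: "m = Suc k" by (cases m) auto
  then have "\<not> y < q ^ k" using not_less_Least[of k "\<lambda>n. y < q ^ n"] by (simp add: m_def)
  then show thesis using that[of k] m k by simp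
qed

section \<open>The auction model, measurability of the bids, and deviation probabilities\<close>

locale ucb_auction = log_concave_cdf DM F f
  for DM :: "real measure" and F f :: "real \<Rightarrow> real" +
  fixes DV :: "real measure" and v \<gamma> :: real
  assumes DV: "prob_space DV" "sets DV = sets borel" "AE x in DV. x \<in> {0..1}"
    and v: "v = prob_space.expectation DV (\<lambda>x. x)"
    and gamma: "\<gamma> > 1"
begin

sublocale V: prob_space DV by (fact DV)

lemma sets_DV [measurable_cong]: "sets DV = sets borel" by (fact DV)

lemma space_D [simp]: "space DV = UNIV" "space DM = UNIV"
  using sets_eq_imp_space_eq[OF sets_DV] sets_eq_imp_space_eq[OF sets_DM] by simp_all

sublocale VM: pair_prob_space DV DM ..

abbreviation "P \<equiv> outcome_space DV DM"

sublocale P: prob_space P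
  unfolding outcome_space_def by (intro prob_space_PiM VM.prob_space_axioms)

lemma space_P [simp]: "space P = UNIV"
  by (simp add: outcome_space_def space_PiM space_pair_measure)

lemma outcome_measurable:
  "(\<lambda>\<omega>. fst (\<omega> s)) \<in> borel_measurable P" "(\<lambda>\<omega>. snd (\<omega> s)) \<in> borel_measurable P"
  unfolding outcome_space_def by measurable

lemma won_measurable:
  assumes "g \<in> borel_measurable P"
  shows "(\<lambda>\<omega>. of_bool (snd (\<omega> s) \<le> g \<omega>) :: real) \<in> borel_measurable P"
  unfolding of_bool_def
  by (intro measurable_If borel_measurable_le borel_measurable_const outcome_measurable assms)

lemma v_bounds: "0 \<le> v" "v \<le> 1"
proof -
  have "integrable DV (\<lambda>x. x)"
    by (rule V.integrable_const_bound[of _ 1]) (use DV(3) in auto)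
  then show "0 \<le> v" "v \<le> 1"
    unfolding v using DV(3)
    by (auto intro!: integral_nonneg_AE V.integral_le_const elim: eventually_mono)
qed

text \<open>Measurability of the argmax follows from its monotonicity in the value.\<close>

lemma opt_bid_measurable [measurable]: "(\<lambda>w. opt_bid w F) \<in> borel_measurable borel"
  by (intro borel_measurable_mono monoI opt_bid_mono cdf_continuous cdf_strict_mono)

lemma cdf_measurable [measurable]: "F \<in> borel_measurable borel"
  by (intro borel_measurable_mono cdf_mono)

abbreviation "bid \<equiv> ucb_bid \<gamma> F"
abbreviation "wins \<equiv> ucb_wins \<gamma> F"
abbreviation "gain \<equiv> ucb_gain \<gamma> F"

lemma bid_measurable [measurable]: "(\<lambda>\<omega>. bid \<omega> t) \<in> borel_measurable P"
proof (induction t rule: less_induct)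
  case (less t)
  consider "t = 0" | "t = Suc 0" | n where "t = Suc n" "n > 0"
    by (cases t) auto
  then show ?case
  proof cases
    case 3
    have [measurable]: "(\<lambda>\<omega>. bid \<omega> s) \<in> borel_measurable P" if "s \<in> {1..n}" for s
      using less 3 that by auto
    have [measurable]: "(\<lambda>\<omega>. wins \<omega> n) \<in> borel_measurable P" "(\<lambda>\<omega>. gain \<omega> n) \<in> borel_measurable P"
      unfolding ucb_wins_def ucb_gain_def
      by (intro borel_measurable_sum borel_measurable_times won_measurable outcome_measurable; simp)+
    show ?thesis
      using 3 by (simp add: ucb_bid_Suc)
  qed simp_all
qed

lemma wins_measurable [measurable]: "(\<lambda>\<omega>. wins \<omega> n) \<in> borel_measurable P"
  and gain_measurable [measurable]: "(\<lambda>\<omega>. gain \<omega> n) \<in> borel_measurable P"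
  unfolding ucb_wins_def ucb_gain_def
  by (intro borel_measurable_sum borel_measurable_times won_measurable outcome_measurable bid_measurable)+

lemma bid_mem: "bid \<omega> t \<in> {0..1}"
proof -
  consider "t = 0" | "t = Suc 0" | n where "t = Suc n" "n > 0"
    by (cases t) auto
  then show ?thesis
    using opt_bid_mem[OF cdf_continuous] by cases (simp_all add: ucb_bid_Suc)
qed

text \<open>Round \<open>s\<close> contributes the factor 1 if lost. For a fixed past and a fixed
  price, winning is decided independently of the value, so Hoeffding's lemma bounds the mean of the
  factor of a won round by 1.\<close>

lemma mgf_gain_le:
  "(\<integral>\<^sup>+\<omega>. ennreal (exp (\<theta> * (gain \<omega> n - v * wins \<omega> n) - \<theta>\<^sup>2 / 8 * wins \<omega> n)) \<partial>P) \<le> 1"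
proof -
  define h where "h s \<omega> z = ennreal (exp (of_bool (snd z \<le> bid \<omega> s) * (\<theta> * (fst z - v) - \<theta>\<^sup>2 / 8)))"
    for s :: nat and \<omega> and z :: "real \<times> real"
  have "ennreal (exp (\<theta> * (gain \<omega> n - v * wins \<omega> n) - \<theta>\<^sup>2 / 8 * wins \<omega> n)) = (\<Prod>s=1..n. h s \<omega> (\<omega> s))" for \<omega>
  proof -
    have "(\<Sum>s=1..n. of_bool (snd (\<omega> s) \<le> bid \<omega> s) * (\<theta> * (fst (\<omega> s) - v) - \<theta>\<^sup>2 / 8))
        = \<theta> * (gain \<omega> n - v * wins \<omega> n) - \<theta>\<^sup>2 / 8 * wins \<omega> n"
      unfolding ucb_gain_def ucb_wins_def sum_distrib_left sum_subtractf[symmetric]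
      by (intro sum.cong refl) (simp add: algebra_simps)
    then show ?thesis
      unfolding h_def by (simp add: prod_ennreal exp_sum[symmetric])
  qed
  moreover have "(\<integral>\<^sup>+\<omega>. (\<Prod>s=1..n. h s \<omega> (\<omega> s)) \<partial>PiM UNIV (\<lambda>_. DV \<Otimes>\<^sub>M DM)) \<le> 1"
  proof (rule nn_integral_PiM_prod_le_1)
    show "prob_space (DV \<Otimes>\<^sub>M DM)" by (rule VM.prob_space_axioms)
    show "(\<lambda>\<omega>. h n \<omega> (\<omega> n)) \<in> borel_measurable (PiM UNIV (\<lambda>_. DV \<Otimes>\<^sub>M DM))" for n
      unfolding h_def outcome_space_def[symmetric]
      by (intro measurable_compose[OF _ measurable_ennreal] measurable_compose[OF _ borel_measurable_exp]
          borel_measurable_times borel_measurable_diff borel_measurable_const won_measurable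
          outcome_measurable bid_measurable)
    show h_meas: "h n \<omega> \<in> borel_measurable (DV \<Otimes>\<^sub>M DM)" for n \<omega>
      unfolding h_def by measurable
    show "h n (fun_upd \<omega> i x) = h n \<omega>" if "n \<le> i" for n i \<omega> x
      using that unfolding h_def by (simp add: ucb_bid_fun_upd)
    show "(\<integral>\<^sup>+z. h n \<omega> z \<partial>(DV \<Otimes>\<^sub>M DM)) \<le> 1" for n \<omega>
    proof -
      have mgf: "(\<integral>\<^sup>+x. ennreal (exp (\<theta> * (x - v) - \<theta>\<^sup>2 / 8)) \<partial>DV) \<le> 1"
      proof -
        have "(\<integral>\<^sup>+x. ennreal (exp (\<theta> * (x - v) - \<theta>\<^sup>2 / 8)) \<partial>DV)
            = (\<integral>\<^sup>+x. ennreal (exp (\<theta> * (x - v))) * ennreal (exp (- \<theta>\<^sup>2 / 8)) \<partial>DV)"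
          by (intro nn_integral_cong) (simp add: ennreal_mult[symmetric] exp_add[symmetric])
        also have "\<dots> = (\<integral>\<^sup>+x. ennreal (exp (\<theta> * (x - v))) \<partial>DV) * ennreal (exp (- \<theta>\<^sup>2 / 8))"
          by (intro nn_integral_multc) measurable
        also have "\<dots> \<le> ennreal (exp (\<theta>\<^sup>2 / 8)) * ennreal (exp (- \<theta>\<^sup>2 / 8))"
          unfolding v by (intro mult_right_mono V.Hoeffding_mgf_unit_interval DV(3)) auto
        also have "\<dots> = 1"
          by (simp add: ennreal_mult[symmetric] exp_add[symmetric])
        finally show ?thesis .
      qed
      have "(\<integral>\<^sup>+z. h n \<omega> z \<partial>(DV \<Otimes>\<^sub>M DM)) = (\<integral>\<^sup>+m. \<integral>\<^sup>+x. h n \<omega> (x, m) \<partial>DV \<partial>DM)"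
        by (intro VM.nn_integral_snd[symmetric] h_meas)
      also have "\<dots> \<le> (\<integral>\<^sup>+m. 1 \<partial>DM)"
      proof (intro nn_integral_mono)
        fix m
        show "(\<integral>\<^sup>+x. h n \<omega> (x, m) \<partial>DV) \<le> 1"
          using mgf by (cases "m \<le> bid \<omega> n") (simp_all add: h_def V.emeasure_space_1[simplified])
      qed
      also have "\<dots> = 1" by (simp add: M.emeasure_space_1[simplified])
      finally show ?thesis .
    qed
  qed
  ultimately show ?thesis
    by (simp add: outcome_space_def)
qed

text \<open>Failure of the confidence interval used in round \<open>n + 1\<close>, multiplied
  through by the number of wins.\<close>

definition dev :: "nat \<Rightarrow> (nat \<Rightarrow> real \<times> real) set" where
  "dev n = {\<omega>. 0 < wins \<omega> n \<and> sqrt (\<gamma> * ln (real n) / 2 * wins \<omega> n) < \<bar>gain \<omega> n - v * wins \<omega> n\<bar>}"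

lemma dev_sets [measurable]: "dev n \<in> sets P"
proof -
  have "{\<omega> \<in> space P. 0 < wins \<omega> n \<and>
    sqrt (\<gamma> * ln (real n) / 2 * wins \<omega> n) < \<bar>gain \<omega> n - v * wins \<omega> n\<bar>} \<in> sets P"
    by measurable
  then show ?thesis by (simp add: dev_def)
qed

text \<open>Wins are integers; thus \<open>sqrt N \<ge> 1\<close> and the slices can start at
  exponent 0.\<close>

lemma one_le_wins: "0 < wins \<omega> n \<Longrightarrow> 1 \<le> wins \<omega> n"
proof -
  have "wins \<omega> n = of_nat (\<Sum>s=1..n. of_bool (snd (\<omega> s) \<le> bid \<omega> s))"
    unfolding ucb_wins_def by simp
  then show "0 < wins \<omega> n \<Longrightarrow> 1 \<le> wins \<omega> n"
    by (metis of_nat_0_less_iff of_nat_1 of_nat_le_iff Suc_leI One_nat_def)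
qed

text \<open>A union bound over at most \<open>1 + ln n / (2 * ln (1 + \<kappa>))\<close> slices and
  two signs, each contributing one exponential moment of mean at most 1.\<close>

lemma prob_dev_le_peeling:
  assumes n: "0 < n" and \<kappa>: "0 < \<kappa>"
  shows "P.prob (dev n) \<le> 2 * (1 + ln (real n) / (2 * ln (1 + \<kappa>))) * real n powr (- \<gamma> * (1 - \<kappa>\<^sup>2))"
proof -
  define x where "x = \<gamma> * ln (real n) / 2"
  define K where "K = nat \<lfloor>ln (real n) / (2 * ln (1 + \<kappa>))\<rfloor>"
  define c where "c = real n powr (- \<gamma> * (1 - \<kappa>\<^sup>2))"
  \<comment> \<open>With \<open>sqrt N = (1 + \<kappa>) ^ k\<close> and deviation
    \<open>D = sqrt (x * N)\<close>, the maximizer \<open>4 * D / N\<close> of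
    \<open>\<theta> * D - \<theta>\<^sup>2 / 8 * N\<close> takes this value.\<close>
  define \<theta> where "\<theta> k = 4 * sqrt x / (1 + \<kappa>) ^ k" for k
  define Y where "Y a \<omega> = ennreal (exp (a * (gain \<omega> n - v * wins \<omega> n) - a\<^sup>2 / 8 * wins \<omega> n))" for a \<omega>
  have x: "0 \<le> x" using n gamma by (simp add: x_def)
  have c: "c = exp (- (2 * x * (1 - \<kappa>\<^sup>2)))" using n by (simp add: c_def x_def powr_def algebra_simps)
  have Y_meas [measurable]: "Y a \<in> borel_measurable P" for a
    unfolding Y_def by measurable
  have Y_le: "(\<integral>\<^sup>+\<omega>. Y a \<omega> \<partial>P) \<le> 1" for a
    unfolding Y_def by (rule mgf_gain_le)
  have "indicator (dev n) \<omega> \<le> ennreal c * (\<Sum>k\<le>K. Y (\<theta> k) \<omega> + Y (- \<theta> k) \<omega>)" for \<omega>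
  proof (cases "\<omega> \<in> dev n")
    case True
    define N D where "N = wins \<omega> n" and "D = gain \<omega> n - v * N"
    have N: "0 < N" "1 \<le> N" "N \<le> real n" and D: "sqrt (x * N) < \<bar>D\<bar>"
      using True one_le_wins[of \<omega> n] ucb_wins_le[of \<gamma> F \<omega> n] by (auto simp: N_def D_def dev_def x_def)
    obtain k where k: "(1 + \<kappa>) ^ k \<le> sqrt N" "sqrt N \<le> (1 + \<kappa>) ^ Suc k"
      using power_bracket[of "1 + \<kappa>" "sqrt N"] \<kappa> N by auto
    \<comment> \<open>The slice index is at most \<open>K\<close> because
      \<open>N \<le> n\<close>.\<close>
    have "ln ((1 + \<kappa>) ^ k) \<le> ln (sqrt (real n))"
      using k(1) N \<kappa> by (intro ln_mono) (auto intro: order_trans[OF k(1)])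
    then have "real k * ln (1 + \<kappa>) \<le> ln (real n) / 2"
      using n \<kappa> by (simp add: ln_realpow ln_sqrt)
    then have kK: "k \<in> {..K}"
      using \<kappa> by (simp add: K_def le_nat_floor field_simps)
    have "2 * x * (1 - \<kappa>\<^sup>2) \<le> \<theta> k * \<bar>D\<bar> - (\<theta> k)\<^sup>2 / 8 * N"
      using D N by (intro peeling_exponent_ge[OF x \<kappa> _ k _ \<theta>_def]) auto
    then have *: "1 \<le> c * exp (\<theta> k * \<bar>D\<bar> - (\<theta> k)\<^sup>2 / 8 * N)"
      unfolding c exp_add[symmetric] by simp
    have "1 \<le> ennreal c * ennreal (exp (\<theta> k * \<bar>D\<bar> - (\<theta> k)\<^sup>2 / 8 * N))"
      using * by (subst ennreal_mult[symmetric]) (auto simp: c ennreal_1[symmetric] simp del: ennreal_1)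
    \<comment> \<open>One of the two signs of the exponent turns \<open>D\<close> into its absolute
      value.\<close>
    also have "ennreal (exp (\<theta> k * \<bar>D\<bar> - (\<theta> k)\<^sup>2 / 8 * N)) \<le> Y (\<theta> k) \<omega> + Y (- \<theta> k) \<omega>"
      by (cases "0 \<le> D") (auto simp: Y_def N_def[symmetric] D_def[symmetric] intro: add_increasing add_increasing2)
    also have "\<dots> \<le> (\<Sum>k\<le>K. Y (\<theta> k) \<omega> + Y (- \<theta> k) \<omega>)"
      using kK by (intro member_le_sum[of k "{..K}"]) auto
    finally show ?thesis
      using True by (simp add: mult_left_mono)
  qed simp
  then have "emeasure P (dev n) \<le> (\<integral>\<^sup>+\<omega>. ennreal c * (\<Sum>k\<le>K. Y (\<theta> k) \<omega> + Y (- \<theta> k) \<omega>) \<partial>P)"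
    by (simp add: nn_integral_mono flip: nn_integral_indicator)
  also have "\<dots> = ennreal c * (\<Sum>k\<le>K. (\<integral>\<^sup>+\<omega>. Y (\<theta> k) \<omega> \<partial>P) + (\<integral>\<^sup>+\<omega>. Y (- \<theta> k) \<omega> \<partial>P))"
    by (simp add: nn_integral_cmult nn_integral_sum nn_integral_add)
  also have "\<dots> \<le> ennreal c * (\<Sum>k\<le>K. 1 + 1)"
    by (intro mult_left_mono sum_mono add_mono Y_le) auto
  also have "(\<Sum>k\<le>K. 1 + 1 :: ennreal) = ennreal (2 * (1 + real K))"
    by (simp add: ennreal_of_nat_eq_real_of_nat ennreal_mult' mult.commute)
  also have "ennreal c * ennreal (2 * (1 + real K)) = ennreal (c * (2 * (1 + real K)))"
    by (intro ennreal_mult[symmetric]) (auto simp: c)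
  finally have "P.prob (dev n) \<le> c * (2 * (1 + real K))"
    by (simp add: P.emeasure_eq_measure c)
  also have "\<dots> \<le> c * (2 * (1 + ln (real n) / (2 * ln (1 + \<kappa>))))"
    using n \<kappa> by (intro mult_left_mono) (auto simp: c K_def)
  finally show ?thesis by (simp add: c_def mult_ac)
qed

lemma prob_dev_sum_bounded: "\<exists>C. \<forall>m. (\<Sum>n<m. P.prob (dev n)) \<le> C"
proof -
  \<comment> \<open>This choice gives \<open>g = (\<gamma> + 1) / 2 > 1\<close>. The logarithmic
    number of slices is absorbed by the power \<open>a\<close>, half of the excess of
    \<open>g\<close> over 1, which leaves the summable exponent
    \<open>a - g = - (g + 1) / 2\<close>.\<close>
  define \<kappa> where "\<kappa> = sqrt ((1 - 1 / \<gamma>) / 2)"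
  define g where "g = \<gamma> * (1 - \<kappa>\<^sup>2)"
  define a where "a = (g - 1) / 2"
  define B where "B = 2 * (1 + 1 / (2 * ln (1 + \<kappa>) * a))"
  have \<kappa>: "0 < \<kappa>" using gamma by (simp add: \<kappa>_def)
  have "\<kappa>\<^sup>2 = (1 - 1 / \<gamma>) / 2" using gamma by (simp add: \<kappa>_def)
  then have "g = (\<gamma> + 1) / 2" using gamma by (simp add: g_def field_simps)
  then have a: "0 < a" and s: "a - g < -1" using gamma by (auto simp: a_def field_simps)
  have B: "0 \<le> B" using a \<kappa> by (simp add: B_def)
  have le: "P.prob (dev n) \<le> B * real n powr (a - g)" if "0 < n" for n
  proof -
    have "ln (real n) \<le> real n powr a / a"
      using that a by (intro ln_powr_bound) auto
    then have "ln (real n) / (2 * ln (1 + \<kappa>)) \<le> (real n powr a / a) / (2 * ln (1 + \<kappa>))"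
      using \<kappa> by (intro divide_right_mono) auto
    moreover have "1 \<le> real n powr a" using that a by (simp add: ge_one_powr_ge_zero)
    ultimately have "2 * (1 + ln (real n) / (2 * ln (1 + \<kappa>)))
        \<le> 2 * (real n powr a + (real n powr a / a) / (2 * ln (1 + \<kappa>)))"
      by simp
    also have "\<dots> = B * real n powr a"
      by (simp add: B_def field_simps)
    finally have "2 * (1 + ln (real n) / (2 * ln (1 + \<kappa>))) * real n powr (- g)
        \<le> B * real n powr a * real n powr (- g)"
      by (intro mult_right_mono) auto
    also have "\<dots> = B * real n powr (a - g)"
      by (simp add: powr_add[symmetric])
    finally show ?thesis
      using prob_dev_le_peeling[OF that \<kappa>] by (simp add: g_def)
  qed
  have sm: "summable (\<lambda>n. B * real n powr (a - g))"
    using s by (intro summable_mult) (simp add: summable_real_powr_iff)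
  show ?thesis
  proof (intro exI allI)
    fix m
    have "(\<Sum>n<m. P.prob (dev n)) \<le> (\<Sum>n<m. B * real n powr (a - g))"

    proof (intro sum_mono)
      \<comment> \<open>For \<open>n = 0\<close> there are no wins, so \<open>dev n\<close> is
        empty.\<close>
      fix n show "P.prob (dev n) \<le> B * real n powr (a - g)"
        using le[of n] by (cases "n = 0") (auto simp: dev_def ucb_wins_def)
    qed
    also have "\<dots> \<le> (\<Sum>n. B * real n powr (a - g))"
      using B by (intro sum_le_suminf sm) auto
    finally show "(\<Sum>n<m. P.prob (dev n)) \<le> (\<Sum>n. B * real n powr (a - g))" .
  qed
qed

end

section \<open>Number of wins and regret\<close>

text \<open>Telescoping with \<open>1 / (m + 1) \<le> ln (m + 1) - ln m\<close>; the term at 0 is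
  \<open>1 / 0 = 0\<close>.\<close>

lemma sum_inverse_le_ln:
  assumes "0 < m"
  shows "(\<Sum>n<m. 1 / real n) \<le> 1 + ln (real m)"
proof -
  have "(\<Sum>n<Suc m. 1 / real n) \<le> 1 + ln (real m)"
    using assms
  proof (induction m rule: nat_induct_non_zero)
    case (Suc m)
    have "ln (real m / real (Suc m)) \<le> real m / real (Suc m) - 1"
      using Suc by (intro ln_le_minus_one) auto
    also have "\<dots> = - (1 / real (Suc m))"
      by (simp add: field_simps)
    finally have "1 / real (Suc m) \<le> ln (real (Suc m)) - ln (real m)"
      using Suc by (simp add: ln_div)
    with Suc.IH show ?case by simp
  qed simp
  moreover have "(\<Sum>n<m. 1 / real n) \<le> (\<Sum>n<Suc m. 1 / real n)"
    by (intro sum_mono2) auto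
  ultimately show ?thesis by linarith
qed

section \<open>Reliable indices, rare low bids and linear growth of the number of wins\<close>

context ucb_auction
begin

text \<open>The first bid is 1 and prices are almost surely at most 1, so round 1 is won and the
  empirical mean is well defined afterwards.\<close>

lemma AE_wins_pos: "AE \<omega> in P. \<forall>n>0. 0 < wins \<omega> n"
proof -
  have "AE z in DV \<Otimes>\<^sub>M DM. snd z \<le> 1"
    by (rule VM.AE_pair_measure) (use DM(3) in auto)
  then have "AE \<omega> in P. snd (\<omega> 1) \<le> 1"
    unfolding outcome_space_def
    by (intro AE_PiM_component VM.prob_space_axioms) auto
  then show ?thesis
  proof eventually_elim
    case (elim \<omega>)
    show ?case
    proof (intro allI impI)
      fix n :: nat assume "n > 0"
      then have "(\<Sum>s\<in>{1}. of_bool (snd (\<omega> s) \<le> bid \<omega> s)) \<le> wins \<omega> n"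
        unfolding ucb_wins_def by (intro sum_mono2) auto
      with elim show "0 < wins \<omega> n" by simp
    qed
  qed
qed

lemma index_bounds:
  assumes "0 < wins \<omega> n" "\<omega> \<notin> dev n"
  defines "\<epsilon> \<equiv> sqrt (\<gamma> * ln (real n) / (2 * wins \<omega> n))"
  shows "v \<le> gain \<omega> n / wins \<omega> n + \<epsilon>" "gain \<omega> n / wins \<omega> n + \<epsilon> \<le> v + 2 * \<epsilon>"
proof -
  define N where "N = wins \<omega> n"
  have N: "0 < N" and D: "\<bar>gain \<omega> n - v * N\<bar> \<le> sqrt (\<gamma> * ln (real n) / 2 * N)"
    using assms(1,2) by (auto simp: N_def dev_def)
  have "\<bar>gain \<omega> n / N - v\<bar> = \<bar>gain \<omega> n - v * N\<bar> / N"
    using N by (simp add: field_simps)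
  also have "\<dots> \<le> sqrt (\<gamma> * ln (real n) / 2 * N) / N"
    using D N by (intro divide_right_mono) auto
  also have "\<dots> = sqrt (\<gamma> * ln (real n) / 2 * N) / sqrt (N\<^sup>2)"
    using N by simp
  also have "\<dots> = \<epsilon>"
    unfolding real_sqrt_divide[symmetric] \<epsilon>_def N_def[symmetric]
    using N by (simp add: power2_eq_square field_simps)
  finally show "v \<le> gain \<omega> n / wins \<omega> n + \<epsilon>" "gain \<omega> n / wins \<omega> n + \<epsilon> \<le> v + 2 * \<epsilon>"
    by (auto simp: N_def)
qed

text \<open>Outside \<open>dev n\<close> the index is at least \<open>v\<close>, and
  \<open>opt_bid\<close> is monotone. For \<open>n = 0\<close> the bid is 1 and cannot be
  low.\<close>

lemma prob_low_bid_le: "P.prob {\<omega>. bid \<omega> (Suc n) < opt_bid v F} \<le> P.prob (dev n)"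
proof (cases "n = 0")
  case True
  then show ?thesis
    using opt_bid_mem[OF cdf_continuous, of v] by simp
next
  case False
  have "AE \<omega> in P. \<omega> \<in> {\<omega>. bid \<omega> (Suc n) < opt_bid v F} \<longrightarrow> \<omega> \<in> dev n"
    using AE_wins_pos
  proof eventually_elim
    case (elim \<omega>)
    show ?case
    proof (rule impI, rule ccontr)
      assume less: "\<omega> \<in> {\<omega>. bid \<omega> (Suc n) < opt_bid v F}" and "\<omega> \<notin> dev n"
      with index_bounds(1)[of \<omega> n] elim False opt_bid_mono[OF cdf_continuous cdf_strict_mono]
      have "opt_bid v F \<le> bid \<omega> (Suc n)"
        by (simp add: ucb_bid_Suc)
      with less show False by simp
    qed
  qed
  then show ?thesis
    by (intro P.finite_measure_mono_AE) auto
qed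

text \<open>The same product argument for i.i.d. factors: each depends only on the price of its own
  round, and \<open>F b\<close> is the mean of the indicator.\<close>

lemma mgf_low_prices_le:
  "(\<integral>\<^sup>+\<omega>. ennreal (exp (\<theta> * (F b * real n - (\<Sum>s=1..n. of_bool (snd (\<omega> s) \<le> b))) - \<theta>\<^sup>2 / 8 * real n)) \<partial>P) \<le> 1"
proof -
  define g where "g m = exp (\<theta> * (F b - of_bool (m \<le> b)) - \<theta>\<^sup>2 / 8)" for m :: real
  have g [measurable]: "g \<in> borel_measurable borel"
    unfolding g_def of_bool_def by measurable
  have "ennreal (exp (\<theta> * (F b * real n - (\<Sum>s=1..n. of_bool (snd (\<omega> s) \<le> b))) - \<theta>\<^sup>2 / 8 * real n))
      = (\<Prod>s=1..n. ennreal (g (snd (\<omega> s))))" for \<omega> :: "nat \<Rightarrow> real \<times> real"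
  proof -
    have "(\<Sum>s=1..n. \<theta> * (F b - of_bool (snd (\<omega> s) \<le> b)) - \<theta>\<^sup>2 / 8)
        = \<theta> * (F b * real n - (\<Sum>s=1..n. of_bool (snd (\<omega> s) \<le> b))) - \<theta>\<^sup>2 / 8 * real n"
      by (simp add: sum_subtractf sum_distrib_left[symmetric] mult.commute)
    then show ?thesis
      unfolding g_def by (simp add: prod_ennreal exp_sum[symmetric])
  qed
  moreover have "(\<integral>\<^sup>+\<omega>. (\<Prod>s=1..n. ennreal (g (snd (\<omega> s)))) \<partial>PiM UNIV (\<lambda>_. DV \<Otimes>\<^sub>M DM)) \<le> 1"
  proof (rule nn_integral_PiM_prod_le_1[where h = "\<lambda>_ _ z. ennreal (g (snd z))"])
    show "prob_space (DV \<Otimes>\<^sub>M DM)" by (rule VM.prob_space_axioms)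
    show "(\<integral>\<^sup>+z. ennreal (g (snd z)) \<partial>(DV \<Otimes>\<^sub>M DM)) \<le> 1"
    proof -
      have E: "M.expectation (\<lambda>m. of_bool (m \<le> b)) = F b"
      proof -
        have "(\<lambda>m. of_bool (m \<le> b)) = (indicator {..b} :: real \<Rightarrow> real)"
          by (auto simp: indicator_def)
        then show ?thesis by (simp add: cdf)
      qed
      have "(\<integral>\<^sup>+z. ennreal (g (snd z)) \<partial>(DV \<Otimes>\<^sub>M DM)) = (\<integral>\<^sup>+m. ennreal (g m) \<partial>DM)"
        by (subst VM.nn_integral_snd[symmetric]) (auto simp: V.emeasure_space_1[simplified])
      also have "\<dots> = (\<integral>\<^sup>+m. ennreal (exp (- \<theta> * (of_bool (m \<le> b) - F b))) * ennreal (exp (- \<theta>\<^sup>2 / 8)) \<partial>DM)"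
        unfolding g_def
        by (intro nn_integral_cong) (simp add: ennreal_mult[symmetric] exp_add[symmetric] algebra_simps)
      also have "\<dots> = (\<integral>\<^sup>+m. ennreal (exp (- \<theta> * (of_bool (m \<le> b) - F b))) \<partial>DM) * ennreal (exp (- \<theta>\<^sup>2 / 8))"
        unfolding of_bool_def by (intro nn_integral_multc) measurable
      also have "\<dots> \<le> ennreal (exp ((- \<theta>)\<^sup>2 / 8)) * ennreal (exp (- \<theta>\<^sup>2 / 8))"
        unfolding E[symmetric] by (intro mult_right_mono M.Hoeffding_mgf_unit_interval) (auto simp: of_bool_def)
      also have "\<dots> = 1"
        by (simp add: ennreal_mult[symmetric] exp_add[symmetric])
      finally show ?thesis .
    qed
  qed auto
  ultimately show ?thesis
    by (simp add: outcome_space_def)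
qed

lemma prob_few_low_prices_le:
  assumes \<delta>: "0 < \<delta>"
  shows "P.prob {\<omega>. (\<Sum>s=1..n. of_bool (snd (\<omega> s) \<le> b)) \<le> (F b - \<delta>) * real n} \<le> exp (- 2 * \<delta>\<^sup>2 * real n)"
    (is "P.prob ?A \<le> _")
proof -
  define X where "X \<omega> = (\<Sum>s=1..n. of_bool (snd (\<omega> s) \<le> b) :: real)" for \<omega> :: "nat \<Rightarrow> real \<times> real"
  have X [measurable]: "X \<in> borel_measurable P"
    unfolding X_def by (intro borel_measurable_sum won_measurable borel_measurable_const)
  have "{\<omega> \<in> space P. X \<omega> \<le> (F b - \<delta>) * real n} \<in> sets P"
    by measurable
  then have A [measurable]: "?A \<in> sets P" by (simp add: X_def)
  \<comment> \<open>The parameter \<open>4 * \<delta>\<close> minimizes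
    \<open>\<theta>\<^sup>2 / 8 - \<theta> * \<delta>\<close>, with minimum
    \<open>- 2 * \<delta>\<^sup>2\<close>.\<close>
  define Y where "Y \<omega> = ennreal (exp (4 * \<delta> * (F b * real n - X \<omega>) - (4 * \<delta>)\<^sup>2 / 8 * real n))" for \<omega>
  have "indicator ?A \<omega> \<le> ennreal (exp (- 2 * \<delta>\<^sup>2 * real n)) * Y \<omega>" for \<omega>
  proof (cases "\<omega> \<in> ?A")
    case True
    then have "\<delta> * real n \<le> F b * real n - X \<omega>" by (simp add: X_def algebra_simps)
    then have "4 * \<delta> * (\<delta> * real n) \<le> 4 * \<delta> * (F b * real n - X \<omega>)"
      using \<delta> by (intro mult_left_mono) auto
    then have "1 \<le> exp (- 2 * \<delta>\<^sup>2 * real n) * exp (4 * \<delta> * (F b * real n - X \<omega>) - (4 * \<delta>)\<^sup>2 / 8 * real n)"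
      unfolding exp_add[symmetric] by (simp add: power2_eq_square)
    then show ?thesis
      using True by (simp add: Y_def ennreal_mult[symmetric] ennreal_1[symmetric] del: ennreal_1)
  qed simp
  then have "emeasure P ?A \<le> (\<integral>\<^sup>+\<omega>. ennreal (exp (- 2 * \<delta>\<^sup>2 * real n)) * Y \<omega> \<partial>P)"
    unfolding nn_integral_indicator[OF A, symmetric] by (rule nn_integral_mono)
  also have "\<dots> = ennreal (exp (- 2 * \<delta>\<^sup>2 * real n)) * (\<integral>\<^sup>+\<omega>. Y \<omega> \<partial>P)"
    unfolding Y_def by (intro nn_integral_cmult) measurable
  also have "\<dots> \<le> ennreal (exp (- 2 * \<delta>\<^sup>2 * real n)) * 1"
    unfolding Y_def X_def by (intro mult_left_mono mgf_low_prices_le) auto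
  finally show ?thesis
    by (simp add: P.emeasure_eq_measure)
qed

text \<open>A round is lost although \<open>M\<^sub>s \<le> b\<^sup>*\<close> only if the bid was below \<open>b\<^sup>*\<close>. The expected number
  of such rounds is bounded, so Markov's inequality makes them a negligible fraction.\<close>

lemma prob_few_wins_le:
  assumes c: "c < F (opt_bid v F)"
  shows "\<exists>C\<ge>0. \<forall>n>0. P.prob {\<omega>. wins \<omega> n < c * real n} \<le> C / real n"
proof -
  define b where "b = opt_bid v F"
  \<comment> \<open>Half of the gap is spent on price fluctuations, the other half on rounds with
    low bids.\<close>
  define \<delta> where "\<delta> = (F b - c) / 2"
  have \<delta>: "0 < \<delta>" using c by (simp add: \<delta>_def b_def)
  obtain K where K: "\<And>m. (\<Sum>n<m. P.prob (dev n)) \<le> K" using prob_dev_sum_bounded by blast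
  have K0: "0 \<le> K" using K[of 0] by simp
  define L where "L s = {\<omega>. bid \<omega> s < b}" for s
  have L [measurable]: "L s \<in> sets P" for s
  proof -
    have "{\<omega> \<in> space P. bid \<omega> s < b} \<in> sets P" by measurable
    then show ?thesis by (simp add: L_def)
  qed
  define Z where "Z n \<omega> = (\<Sum>s=1..n. indicator (L s) \<omega> :: real)" for n \<omega>
  define X where "X n \<omega> = (\<Sum>s=1..n. of_bool (snd (\<omega> s) \<le> b) :: real)" for n and \<omega> :: "nat \<Rightarrow> real \<times> real"
  have int: "integrable P (Z n)" for n
    unfolding Z_def by (intro Bochner_Integration.integrable_sum integrable_real_indicator) (auto simp: P.emeasure_eq_measure)
  have X [measurable]: "X n \<in> borel_measurable P" for n
    unfolding X_def by (intro borel_measurable_sum won_measurable borel_measurable_const)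
  have Z_nonneg: "0 \<le> Z n \<omega>" for n \<omega>
    unfolding Z_def by (intro sum_nonneg) auto
  have EZ: "P.expectation (Z n) \<le> K" for n
  proof -
    have "P.expectation (Z n) = (\<Sum>s=1..n. P.prob (L s))"
      unfolding Z_def by (subst Bochner_Integration.integral_sum) (auto simp: P.emeasure_eq_measure)
    also have "\<dots> = (\<Sum>k<n. P.prob (L (Suc k)))"
      by (simp add: sum.atLeast1_atMost_eq)
    also have "\<dots> \<le> (\<Sum>k<n. P.prob (dev k))"
      unfolding L_def b_def by (intro sum_mono prob_low_bid_le)
    finally show ?thesis using K[of n] by simp
  qed
  have wins_ge: "X n \<omega> - Z n \<omega> \<le> wins \<omega> n" for n \<omega>
    unfolding X_def Z_def ucb_wins_def sum_subtractf[symmetric]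
    by (intro sum_mono) (auto simp: L_def indicator_def)
  have main: "P.prob {\<omega>. wins \<omega> n < c * real n} \<le> (K / \<delta> + 1 / (2 * \<delta>\<^sup>2)) / real n" if n: "0 < n" for n
  proof -
    let ?A = "{\<omega>. X n \<omega> \<le> (F b - \<delta>) * real n}" and ?B = "{\<omega>. \<delta> * real n \<le> Z n \<omega>}"
    have "{\<omega> \<in> space P. X n \<omega> \<le> (F b - \<delta>) * real n} \<in> sets P" by measurable
    moreover have "{\<omega> \<in> space P. \<delta> * real n \<le> Z n \<omega>} \<in> sets P" using int by measurable
    ultimately have sets [measurable]: "?A \<in> sets P" "?B \<in> sets P" by simp_all
    have "{\<omega>. wins \<omega> n < c * real n} \<subseteq> ?A \<union> ?B"
    proof
      fix \<omega> assume "\<omega> \<in> {\<omega>. wins \<omega> n < c * real n}"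
      then have "X n \<omega> - Z n \<omega> < c * real n" using wins_ge[of n \<omega>] by simp
      also have "c * real n = (F b - \<delta>) * real n - \<delta> * real n"
        by (simp add: \<delta>_def field_simps)
      finally show "\<omega> \<in> ?A \<union> ?B" by auto
    qed
    then have "P.prob {\<omega>. wins \<omega> n < c * real n} \<le> P.prob (?A \<union> ?B)"
      by (intro P.finite_measure_mono sets.Un sets)
    also have "\<dots> \<le> P.prob ?A + P.prob ?B"
      by (rule measure_Un_le[OF sets])
    also have "P.prob ?B \<le> P.expectation (Z n) / (\<delta> * real n)"
      using integral_Markov_inequality_measure[OF int sets.empty_sets, of n "\<delta> * real n"] \<delta> n Z_nonneg
      by simp
    also have "\<dots> \<le> K / (\<delta> * real n)"
      using EZ \<delta> by (intro divide_right_mono) auto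
    also have "P.prob ?A \<le> exp (- 2 * \<delta>\<^sup>2 * real n)"
      unfolding X_def by (rule prob_few_low_prices_le[OF \<delta>])
    also have "\<dots> \<le> 1 / (2 * \<delta>\<^sup>2 * real n)"
    proof -
      have "2 * \<delta>\<^sup>2 * real n \<le> exp (2 * \<delta>\<^sup>2 * real n)"
        using exp_ge_add_one_self[of "2 * \<delta>\<^sup>2 * real n"] by linarith
      then show ?thesis
        using \<delta> n by (simp add: exp_minus divide_simps)
    qed
    also have "1 / (2 * \<delta>\<^sup>2 * real n) + K / (\<delta> * real n) = (K / \<delta> + 1 / (2 * \<delta>\<^sup>2)) / real n"
      by (simp add: add_divide_distrib)
    finally show ?thesis by simp
  qed
  show ?thesis
    by (rule exI[of _ "K / \<delta> + 1 / (2 * \<delta>\<^sup>2)"]) (use main \<delta> K0 in auto)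
qed

section \<open>Regret of a single round and its sum over all rounds\<close>

lemma abs_util_le_1: "b \<in> {0..1} \<Longrightarrow> \<bar>util v F b\<bar> \<le> 1"
  unfolding util_def abs_mult
  using v_bounds cdf_nonneg[of b] cdf_le_1[of b] by (intro mult_le_one) auto

lemma util_bid_measurable: "(\<lambda>\<omega>. util v F (bid \<omega> t)) \<in> borel_measurable P"
  unfolding util_def by measurable

lemma util_bid_integrable: "integrable P (\<lambda>\<omega>. util v F (bid \<omega> t))"
  by (rule P.integrable_const_bound[of _ 1]) (auto intro: util_bid_measurable abs_util_le_1 bid_mem)

lemma Sup_util: "Sup (util v F ` {0..1}) = util v F (opt_bid v F)"
  using util_le_opt_bid[OF cdf_continuous] opt_bid_mem[OF cdf_continuous]
  by (intro cSup_eq_maximum) auto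

lemma util_loss_le_square:
  assumes dens: "\<And>b. b \<in> {0..1} \<Longrightarrow> b \<in> {opt_bid v F .. opt_bid v F + \<Delta>} \<Longrightarrow> f b \<le> C"
    and C: "0 \<le> C" and pos: "0 < F (opt_bid v F)" and w: "v \<le> w" "w \<le> v + \<Delta>"
  shows "util v F (opt_bid v F) - util v F (opt_bid w F) \<le> C * (w - v)\<^sup>2"
proof -
  define b b' where "b = opt_bid v F" and "b' = opt_bid w F"
  have mem: "b \<in> {0..1}" "b' \<in> {0..1}"
    unfolding b_def b'_def by (intro opt_bid_mem cdf_continuous)+
  have le: "b \<le> b'"
    unfolding b_def b'_def by (intro opt_bid_mono cdf_continuous cdf_strict_mono w)
  have lip: "b' - b \<le> w - v"
    unfolding b_def b'_def
    by (intro opt_bid_Lipschitz cdf_continuous cdf_strict_mono cdf_nonneg cdf_log_concave v_bounds w pos)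
  have "F b' - F b \<le> C * (b' - b)"
  proof (cases "b = b'")
    case False
    with le have "b < b'" by simp
    moreover have "(F has_derivative (\<lambda>h. f x * h)) (at x within {b..b'})" if "b \<le> x" "x \<le> b'" for x
      using has_field_derivative_subset[OF deriv[of x], of "{b..b'}"] that mem
      unfolding has_field_derivative_def by auto
    ultimately obtain x where x: "x \<in> {b<..<b'}" "F b' - F b = f x * (b' - b)"
      using mvt_simple[of b b' F "\<lambda>x h. f x * h"] by auto
    \<comment> \<open>The Lipschitz bound and \<open>w \<le> v + \<Delta>\<close> keep the mean
      value point where the density is bounded.\<close>
    moreover have "f x \<le> C"
      using x mem lip w by (intro dens) (auto simp: b_def[symmetric])
    ultimately show ?thesis
      using le by (simp add: mult_right_mono)
  qed simp
  also have "\<dots> \<le> C * (w - v)"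
    using lip C by (intro mult_left_mono)
  finally have "(w - v) * (F b' - F b) \<le> (w - v) * (C * (w - v))"
    using w by (intro mult_left_mono) auto
  then show ?thesis
    using util_opt_bid_diff_le[OF cdf_continuous, of v w]
    by (simp add: b_def b'_def power2_eq_square mult_ac)
qed

text \<open>Either failure, \<open>dev n\<close> or too few wins, costs at most 2. Otherwise the
  quadratic loss bound applies with
  \<open>(2 * \<epsilon>)\<^sup>2 = 2 * \<gamma> * ln n / N\<close> and
  \<open>N \<ge> c * n\<close>.\<close>

lemma round_regret_le:
  assumes \<Delta>: "0 < \<Delta>" and C: "0 < C"
    and dens: "\<And>b. b \<in> {0..1} \<Longrightarrow> b \<in> {opt_bid v F .. opt_bid v F + \<Delta>} \<Longrightarrow> f b \<le> C"
    and c: "0 < c" "c < F (opt_bid v F)"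
  shows "\<exists>B\<ge>0. \<forall>\<^sub>F n in sequentially. util v F (opt_bid v F) - P.expectation (\<lambda>\<omega>. util v F (bid \<omega> (Suc n)))
    \<le> 2 * \<gamma> * C / c * (ln (real n) / real n) + 2 * P.prob (dev n) + B / real n"
proof -
  obtain K where K: "0 \<le> K" "\<And>n. 0 < n \<Longrightarrow> P.prob {\<omega>. wins \<omega> n < c * real n} \<le> K / real n"
    using prob_few_wins_le[OF c(2)] by blast
  \<comment> \<open>For large \<open>n\<close> this forces
    \<open>2 * \<epsilon> \<le> \<Delta>\<close>, so the index stays in the range of the quadratic
    loss bound.\<close>
  have "(\<lambda>n. 2 * \<gamma> / c * (ln (real n) / real n)) \<longlonglongrightarrow> 2 * \<gamma> / c * 0"
    by (intro tendsto_mult_left lim_ln_over_n)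
  then have "\<forall>\<^sub>F n in sequentially. 2 * \<gamma> / c * (ln (real n) / real n) < \<Delta>\<^sup>2"
    by (rule order_tendstoD(2)) (use \<Delta> in simp)
  then have "\<forall>\<^sub>F n in sequentially. util v F (opt_bid v F) - P.expectation (\<lambda>\<omega>. util v F (bid \<omega> (Suc n)))
    \<le> 2 * \<gamma> * C / c * (ln (real n) / real n) + 2 * P.prob (dev n) + 2 * K / real n"
    using eventually_gt_at_top[of 0]
  proof eventually_elim
    case (elim n)
    let ?E = "{\<omega>. wins \<omega> n < c * real n}" and ?a = "2 * \<gamma> * C / c * (ln (real n) / real n)"
    have "{\<omega> \<in> space P. wins \<omega> n < c * real n} \<in> sets P" by measurable
    then have [measurable]: "?E \<in> sets P" by simp
    have a: "0 \<le> ?a" using gamma C c elim by simp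
    have pt: "util v F (opt_bid v F) - util v F (bid \<omega> (Suc n))
      \<le> ?a + 2 * indicator (dev n) \<omega> + 2 * indicator ?E \<omega>" for \<omega>
    proof (cases "\<omega> \<in> dev n \<union> ?E")
      case True
      have "util v F (opt_bid v F) - util v F (bid \<omega> (Suc n)) \<le> 2"
        using abs_util_le_1[OF opt_bid_mem[OF cdf_continuous, of v]] abs_util_le_1[OF bid_mem[of \<omega> "Suc n"]]
        by linarith
      also have "2 \<le> 2 * indicator (dev n) \<omega> + 2 * (indicator ?E \<omega> :: real)"
        using True by (auto simp: indicator_def)
      finally show ?thesis using a by simp
    next
      case False
      define \<epsilon> where "\<epsilon> = sqrt (\<gamma> * ln (real n) / (2 * wins \<omega> n))"
      define w where "w = gain \<omega> n / wins \<omega> n + \<epsilon>"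
      have N: "c * real n \<le> wins \<omega> n" using False by auto
      moreover have cn: "0 < c * real n" using c elim by simp
      ultimately have N0: "0 < wins \<omega> n" by linarith
      have w: "v \<le> w" "w \<le> v + 2 * \<epsilon>"
        using index_bounds[of \<omega> n] N0 False by (auto simp: w_def \<epsilon>_def)
      have "(2 * \<epsilon>)\<^sup>2 = 2 * \<gamma> * ln (real n) / wins \<omega> n"
        using N0 gamma elim by (simp add: \<epsilon>_def power_mult_distrib)
      also have "\<dots> \<le> 2 * \<gamma> * ln (real n) / (c * real n)"
        using N cn gamma elim by (intro divide_left_mono) auto
      also have "\<dots> = 2 * \<gamma> / c * (ln (real n) / real n)"
        by simp
      finally have eps: "(2 * \<epsilon>)\<^sup>2 \<le> 2 * \<gamma> / c * (ln (real n) / real n)" .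
      then have "(2 * \<epsilon>)\<^sup>2 \<le> \<Delta>\<^sup>2" using elim by simp
      then have "2 * \<epsilon> \<le> \<Delta>" using \<Delta> power2_le_imp_le[of "2 * \<epsilon>" \<Delta>] by simp
      then have "util v F (opt_bid v F) - util v F (opt_bid w F) \<le> C * (w - v)\<^sup>2"
        using w C c by (intro util_loss_le_square[OF dens]) auto
      also have "\<dots> \<le> C * (2 * \<epsilon>)\<^sup>2"
        using w C by (intro mult_left_mono power_mono) auto
      also have "\<dots> \<le> C * (2 * \<gamma> / c * (ln (real n) / real n))"
        using eps C by (intro mult_left_mono) auto
      finally show ?thesis
        using False elim by (simp add: ucb_bid_Suc w_def \<epsilon>_def mult_ac)
    qed
    have "util v F (opt_bid v F) - P.expectation (\<lambda>\<omega>. util v F (bid \<omega> (Suc n)))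
        = P.expectation (\<lambda>\<omega>. util v F (opt_bid v F) - util v F (bid \<omega> (Suc n)))"
      using util_bid_integrable by (simp add: P.prob_space[simplified])
    also have "\<dots> \<le> P.expectation (\<lambda>\<omega>. ?a + 2 * indicator (dev n) \<omega> + 2 * indicator ?E \<omega>)"
      using util_bid_integrable pt by (intro integral_mono) (auto simp: P.emeasure_eq_measure)
    also have "\<dots> = ?a + 2 * P.prob (dev n) + 2 * P.prob ?E"
      by (simp add: P.emeasure_eq_measure P.prob_space[simplified])
    also have "\<dots> \<le> ?a + 2 * P.prob (dev n) + 2 * K / real n"
      using K(2)[of n] elim by simp
    finally show ?case .
  qed
  with K(1) show ?thesis by (intro exI[of _ "2 * K"]) auto
qed

lemma ucb_regret_le:
  assumes "0 < \<Delta>" "0 < C"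
    and "\<And>b. b \<in> {0..1} \<Longrightarrow> b \<in> {opt_bid v F .. opt_bid v F + \<Delta>} \<Longrightarrow> f b \<le> C"
    and c: "0 < c" "c < F (opt_bid v F)"
  shows "\<exists>K. \<forall>\<^sub>F T in sequentially.
    ucb_regret \<gamma> DV DM v F T \<le> 2 * \<gamma> * C / c * (ln (real T))\<^sup>2 + K * ln (real T)"
proof -
  define A where "A = 2 * \<gamma> * C / c"
  define r where "r n = util v F (opt_bid v F) - P.expectation (\<lambda>\<omega>. util v F (bid \<omega> (Suc n)))" for n
  have A: "0 \<le> A" using gamma assms(2) c by (simp add: A_def)
  obtain B n0 where B: "0 \<le> B"
    and n0: "\<And>n. n0 \<le> n \<Longrightarrow> r n \<le> A * (ln (real n) / real n) + 2 * P.prob (dev n) + B / real n"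
    using round_regret_le[OF assms] unfolding eventually_sequentially r_def A_def by blast
  obtain D where D: "\<And>m. (\<Sum>n<m. P.prob (dev n)) \<le> D" using prob_dev_sum_bounded by blast
  have D0: "0 \<le> D" using D[of 0] by simp
  have r2: "r n \<le> 2" for n
  proof -
    have "P.expectation (\<lambda>\<omega>. util v F (bid \<omega> (Suc n))) \<ge> -1"
      using abs_util_le_1[OF bid_mem]
      by (intro P.integral_ge_const util_bid_integrable) (auto simp: abs_le_iff minus_le_iff)
    then show ?thesis
      using abs_util_le_1[OF opt_bid_mem[OF cdf_continuous, of v]] by (simp add: r_def)
  qed
  have "ucb_regret \<gamma> DV DM v F T \<le> A * (ln (real T))\<^sup>2 + (2 * real n0 + A + 2 * D + 2 * B) * ln (real T)"
    if T: "3 \<le> T" for T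
  proof -
    \<comment> \<open>Since \<open>T \<ge> 3 > e\<close>, every constant can be absorbed into a
      multiple of \<open>ln T\<close>.\<close>
    have ln_ge: "1 \<le> ln (real T)"
    proof -
      have "exp 1 \<le> real T" using exp_le T by linarith
      then show ?thesis using T by (simp add: ln_ge_iff)
    qed
    have "ucb_regret \<gamma> DV DM v F T = (\<Sum>n<T. r n)"
      unfolding ucb_regret_def Sup_util r_def
      by (simp add: sum_subtractf sum.atLeast1_atMost_eq)
    \<comment> \<open>The first \<open>n0\<close> rounds cost at most 2 each; later,
      \<open>ln n \<le> ln T\<close> reduces the leading term to a harmonic sum.\<close>
    also have "\<dots> \<le> (\<Sum>n<T. 2 * of_bool (n < n0) + A * ln (real T) * (1 / real n)
        + 2 * P.prob (dev n) + B * (1 / real n))"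
    proof (intro sum_mono)
      fix n assume n: "n \<in> {..<T}"
      have "0 \<le> A * ln (real T) * (1 / real n)" "0 \<le> B * (1 / real n)"
        using A B ln_ge by auto
      moreover have "A * (ln (real n) / real n) \<le> A * ln (real T) * (1 / real n)"
      proof (cases "n = 0")
        case False
        then have "ln (real n) / real n \<le> ln (real T) / real n"
          using n by (intro divide_right_mono) auto
        then show ?thesis using mult_left_mono[OF _ A] by fastforce
      qed simp
      ultimately show "r n \<le> 2 * of_bool (n < n0) + A * ln (real T) * (1 / real n)
        + 2 * P.prob (dev n) + B * (1 / real n)"
        using r2[of n] n0[of n] measure_nonneg[of P "dev n"] by (cases "n < n0") (simp_all del: measure_nonneg)
    qed
    also have "\<dots> = 2 * (\<Sum>n<T. of_bool (n < n0)) + A * ln (real T) * (\<Sum>n<T. 1 / real n)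
        + 2 * (\<Sum>n<T. P.prob (dev n)) + B * (\<Sum>n<T. 1 / real n)"
      unfolding sum.distrib sum_distrib_left ..
    also have "\<dots> \<le> 2 * real n0 + A * ln (real T) * (1 + ln (real T)) + 2 * D + B * (1 + ln (real T))"
    proof (intro add_mono mult_left_mono sum_inverse_le_ln D)
      have "(\<Sum>n<T. of_bool (n < n0)) = real (card ({..<T} \<inter> {n. n < n0}))"
        by (simp add: of_bool_def sum.If_cases)
      also have "\<dots> \<le> real (card {..<n0})"
        by (intro of_nat_mono card_mono) auto
      finally show "(\<Sum>n<T. of_bool (n < n0)) \<le> real n0" by simp
    qed (use A B ln_ge T in auto)
    also have "\<dots> \<le> A * (ln (real T))\<^sup>2 + (2 * real n0 + A + 2 * D + 2 * B) * ln (real T)"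
    proof -
      have "(2 * real n0 + 2 * D + B) * 1 \<le> (2 * real n0 + 2 * D + B) * ln (real T)"
        using D0 B ln_ge by (intro mult_left_mono) auto
      then show ?thesis by (simp add: power2_eq_square algebra_simps)
    qed
    finally show ?thesis .
  qed
  then show ?thesis
    unfolding A_def[symmetric] eventually_sequentially by blast
qed

end

section \<open>Choice of the win rate and comparison of the constants\<close>

theorem theorem3:
  fixes DV DM :: "real measure" and v \<gamma> \<Delta> c_f C_f lam :: real
    and F f :: "real \<Rightarrow> real"
  assumes DV: "prob_space DV" "sets DV = sets borel" "AE x in DV. x \<in> {0..1}"
      and v: "v = prob_space.expectation DV (\<lambda>x. x)"
      and DM: "prob_space DM" "sets DM = sets borel" "AE x in DM. x \<in> {0..1}"
      and cdf: "\<And>b. measure DM {..b} = F b"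
      (* Assumption 1 *)
      and deriv: "\<And>b. b \<in> {0..1} \<Longrightarrow> (F has_real_derivative f b) (at b within {0..1})"
      and f_cont: "continuous_on {0..1} f"
      and logconc: "\<And>x y. 0 < x \<Longrightarrow> x < y \<Longrightarrow> y < 1 \<Longrightarrow> f y / F y < f x / F x"
      (* Assumption 2 *)
      and Delta: "\<Delta> > 0" and cf: "c_f > 0"
      and dens_bounds: "\<And>b. b \<in> {0..1} \<Longrightarrow> b \<in> {opt_bid v F - \<Delta> .. opt_bid v F + \<Delta>} \<Longrightarrow>
                         c_f < f b \<and> f b < C_f"
      and phi_deriv: "\<And>b. b \<in> {0..1} \<Longrightarrow> b \<in> {opt_bid v F .. opt_bid v F + \<Delta>} \<Longrightarrow>
                         \<exists>d. ((\<lambda>x. x + F x / f x) has_real_derivative d) (at b within {0..1}) \<and> d \<le> lam"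
      and Fpos: "F (opt_bid v F) > 0"
      and gamma: "\<gamma> > 1"
  shows "\<exists>K. \<forall>\<^sub>F T in sequentially.
           ucb_regret \<gamma> DV DM v F T
             \<le> 2 * \<gamma> * lam * C_f\<^sup>2 / (F (opt_bid v F) * c_f) * (ln (real T))\<^sup>2 + K * ln (real T)"
proof -
  interpret ucb_auction DM F f DV v \<gamma>
    by (intro ucb_auction.intro log_concave_cdf.intro ucb_auction_axioms.intro)
      (fact DM cdf deriv logconc DV v gamma)+
  define b where "b = opt_bid v F"
  have b: "b \<in> {0..1}"
    unfolding b_def by (rule opt_bid_mem[OF cdf_continuous])
  have cC: "c_f < C_f"
    using dens_bounds[of b] b Delta by (auto simp: b_def)
  \<comment> \<open>If bidding 1 were optimal, comparison with bid 0 would force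
    \<open>v = 1\<close>, and then bid 1/2 would earn strictly more.\<close>
  have "b < 1"
  proof (rule ccontr)
    assume "\<not> b < 1"
    with b have "b = 1" by simp
    then have "opt_bid v F = 1" by (simp add: b_def)
    then have opt: "util v F x \<le> v - 1" if "x \<in> {0..1}" for x
      using util_le_opt_bid[OF cdf_continuous that, of v] by (simp add: util_def cdf_1)
    have "0 \<le> util v F 0" using v_bounds cdf_nonneg by (simp add: util_def)
    with opt[of 0] v_bounds have "v = 1" by simp
    with opt[of "1 / 2"] density_cdf_pos(2)[of "1 / 2"] show False
      by (simp add: util_def)
  qed
  have lam: "1 \<le> lam"
  proof -
    \<comment> \<open>The slope bound is read off at an interior point, as \<open>b\<close> itself
      may be 0.\<close>
    define x where "x = min ((b + 1) / 2) (b + \<Delta>)"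
    have x: "0 < x" "x < 1" "b \<le> x" "x \<le> b + \<Delta>"
      using b \<open>b < 1\<close> Delta by (auto simp: x_def min_def)
    then obtain d where "((\<lambda>x. x + F x / f x) has_real_derivative d) (at x within {0..1})" "d \<le> lam"
      using phi_deriv[of x] by (auto simp: b_def)
    with one_le_reserve_slope[of x d] x show ?thesis by simp
  qed
  \<comment> \<open>Strictness of \<open>c_f < C_f\<close> puts \<open>c\<close> below
    \<open>F b\<close>, and \<open>C_f / c\<close> is exactly
    \<open>C_f\<^sup>2 / (F b * c_f)\<close>.\<close>
  define c where "c = F b * (c_f / C_f)"
  have "c_f / C_f < 1" "0 < c_f / C_f" using cC cf by auto
  then have c: "0 < c" "c < F b"
    using Fpos mult_strict_left_mono[of "c_f / C_f" 1 "F b"] mult_pos_pos[of "F b" "c_f / C_f"]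
    by (auto simp: c_def b_def)
  have "f y \<le> C_f" if "y \<in> {0..1}" "y \<in> {opt_bid v F..opt_bid v F + \<Delta>}" for y
    using dens_bounds[of y] that Delta by auto
  then obtain K where K: "\<forall>\<^sub>F T in sequentially.
      ucb_regret \<gamma> DV DM v F T \<le> 2 * \<gamma> * C_f / c * (ln (real T))\<^sup>2 + K * ln (real T)"
    using ucb_regret_le[of \<Delta> C_f c] Delta cC cf c by (auto simp: b_def)
  have "2 * \<gamma> * C_f / c = 1 * (2 * \<gamma> * C_f\<^sup>2 / (F b * c_f))"
    using cC cf Fpos by (simp add: c_def b_def power2_eq_square)
  also have "\<dots> \<le> lam * (2 * \<gamma> * C_f\<^sup>2 / (F b * c_f))"
    using lam gamma cf Fpos by (intro mult_right_mono) (auto simp: b_def)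
  also have "\<dots> = 2 * \<gamma> * lam * C_f\<^sup>2 / (F (opt_bid v F) * c_f)"
    by (simp add: b_def)
  finally have le: "2 * \<gamma> * C_f / c \<le> 2 * \<gamma> * lam * C_f\<^sup>2 / (F (opt_bid v F) * c_f)" .
  from K have "\<forall>\<^sub>F T in sequentially. ucb_regret \<gamma> DV DM v F T
      \<le> 2 * \<gamma> * lam * C_f\<^sup>2 / (F (opt_bid v F) * c_f) * (ln (real T))\<^sup>2 + K * ln (real T)"
  proof eventually_elim
    case (elim T)
    with mult_right_mono[OF le, of "(ln (real T))\<^sup>2"] show ?case by simp
  qed
  then show ?thesis ..
qed

end
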